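(* Let $\{(x^k,y^k,s^k,\mu^k)\}\subset\mathbb{R}^n\times\mathbb{R}^m\times\mathbb{R}^m\times\mathbb{R}$ with $\mu^k>0$ and $\mu^k\to 0$ be such that: 1. $x^k\to x^*$ with $a(x^* )\le 0$, and $s^k\to s^*:=-a(x^* )$; 2. $y^k\ge 0$ and $s^k\ge 0$ with $y^k\to y^*$ ($y^*$ is necessarily a Lagrange multiplier associated with $x^*$); 3. for some $0<b\le c$ (independent of $k$), $\mu^k b\le y_i^k s_i^k$ for all $i$ with $a_i(x^* )=0$, and $(y^k)^{T}s^k\le\mu^k c$; 4. for some $u\ge 0$ (independent of $k$), $|a_i(x^k)+s_i^k|\le\mu^k u$ for all $i$ with $a_i(x^* )=0$; 5. for some $d\ge 0$ (independent of $k$), $\|\nabla_x\mathcal{L}(x^k,y^k)\|\le d\mu^k(\|y^k\|_1+1)$; 6. either the functions $f$ and $a_i$, $i=1,\dots,m$, are convex; or both of the following hold: (i) for some $\theta\ge 0$ there are a neighborhood $S$ of $x^*$ and a neighborhood $W$ of $y^*$ such that for all $y\in W$ the function $x\mapsto\tilde{\mathcal{L}}(x,y)$ is star-convex around $x^*$ on $S$, where $$\tilde{\mathcal{L}}(x,y):=\mathcal{L}(x,y)+\theta\sum_{i:a_i(x^* )=0}\bigl(\nabla a_i(x^* )^{T}(x-x^* )\bigr)^2,$$ and (ii) there is a constant $C\ge 0$ such that $\|x^k-x^*\|\le C\sqrt{\mu^k}$. Then $y^*$ is maximally complementary, i.e., $y_i^*>0$ whenever there exists some Lagrange multiplier $\tilde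 y$ associated with $x^*$ with $\tilde y_i>0$.
   Context: The functions $f:\mathbb{R}^n\to\mathbb{R}$ and $a=(a_1,\dots,a_m):\mathbb{R}^n\to\mathbb{R}^m$ are continuously differentiable. The problem under consideration is: minimize $f(x)$ subject to $a(x)+s=0$, $s\ge 0$ (equivalently, minimize $f(x)$ subject to $a(x)\le 0$). Vector inequalities are componentwise. The Lagrangian is $\mathcal{L}(x,y):=f(x)+y^{T}a(x)$. A Lagrange multiplier associated with a feasible point $x^*$ is a vector $y^*\in\mathbb{R}^m$ with $\nabla_x\mathcal{L}(x^*,y^* )=0$, $y^*\ge 0$ and $a(x^* )^{T}y^*=0$. A function $q:\mathbb{R}^n\to\mathbb{R}$ is star-convex around $x^*$ on a set $S\subseteq\mathbb{R}^n$ if $q(\alpha x+(1-\alpha)x^* )\le\alpha q(x)+(1-\alpha)q(x^* )$ for all $\alpha\in[0,1]$ and $x\in S$. $\|\cdot\|$ is the Euclidean norm, $\|\cdot\|_1$ the $\ell_1$-norm. Conditions on sequence elements stated without an explicit quantifier over $k$ are meant for all sufficiently large $k$. *)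

theory Defs
  imports "HOL-Analysis.Analysis"
begin

definition continuously_differentiable ::
    "('a::real_normed_vector \<Rightarrow> 'b::real_normed_vector) \<Rightarrow> bool" where
  "continuously_differentiable g \<longleftrightarrow>
     (\<exists>g'. (\<forall>x. (g has_derivative blinfun_apply (g' x)) (at x)) \<and> continuous_on UNIV g')"

text \<open>Meaningful only where \<open>g\<close> is differentiable, see \<open>gradient_eqI\<close>.\<close>

definition gradient :: "('a::real_inner \<Rightarrow> real) \<Rightarrow> 'a \<Rightarrow> 'a" where
  "gradient g x = (THE D. GDERIV g x :> D)"

lemma gradient_eqI:
  assumes "GDERIV g x :> D"
  shows "gradient g x = D"
  unfolding gradient_def
proof (rule the_equality)
  fix E assume "GDERIV g x :> E"
  then have "(\<lambda>h. h \<bullet> E) = (\<lambda>h. h \<bullet> D)"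
    using assms unfolding gderiv_def by (rule has_derivative_unique)
  then show "E = D"
    by (metis inner_commute vector_eq_ldot)
qed (fact assms)

definition norm1 :: "real ^ 'm \<Rightarrow> real" where
  "norm1 y = (\<Sum>i\<in>UNIV. \<bar>y $ i\<bar>)"

definition lagrangian ::
    "(real ^ 'n \<Rightarrow> real) \<Rightarrow> (real ^ 'n \<Rightarrow> real ^ 'm) \<Rightarrow> real ^ 'n \<Rightarrow> real ^ 'm \<Rightarrow> real" where
  "lagrangian f a x y = f x + y \<bullet> a x"

text \<open>The order on vectors, here and below, is the componentwise one.\<close>

definition lagrange_multiplier ::
    "(real ^ 'n \<Rightarrow> real) \<Rightarrow> (real ^ 'n \<Rightarrow> real ^ 'm) \<Rightarrow> real ^ 'n \<Rightarrow> real ^ 'm \<Rightarrow> bool" where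
  "lagrange_multiplier f a x y \<longleftrightarrow>
     a x \<le> 0 \<and> gradient (\<lambda>z. lagrangian f a z y) x = 0 \<and> 0 \<le> y \<and> a x \<bullet> y = 0"

definition aug_lagrangian ::
    "(real ^ 'n \<Rightarrow> real) \<Rightarrow> (real ^ 'n \<Rightarrow> real ^ 'm) \<Rightarrow> real ^ 'n \<Rightarrow> real
      \<Rightarrow> real ^ 'n \<Rightarrow> real ^ 'm \<Rightarrow> real" where
  "aug_lagrangian f a xs \<theta> x y =
     lagrangian f a x y
     + \<theta> * (\<Sum>i\<in>{i. a xs $ i = 0}. (gradient (\<lambda>z. a z $ i) xs \<bullet> (x - xs))\<^sup>2)"

definition star_convex_around ::
    "('a::real_vector \<Rightarrow> real) \<Rightarrow> 'a \<Rightarrow> 'a set \<Rightarrow> bool" where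
  "star_convex_around q xs S \<longleftrightarrow>
     (\<forall>\<alpha>\<in>{0..1}. \<forall>x\<in>S. q (\<alpha> *\<^sub>R x + (1 - \<alpha>) *\<^sub>R xs) \<le> \<alpha> * q x + (1 - \<alpha>) * q xs)"

definition maximally_complementary ::
    "(real ^ 'n \<Rightarrow> real) \<Rightarrow> (real ^ 'n \<Rightarrow> real ^ 'm) \<Rightarrow> real ^ 'n \<Rightarrow> real ^ 'm \<Rightarrow> bool" where
  "maximally_complementary f a x y \<longleftrightarrow>
     (\<forall>i. (\<exists>y'. lagrange_multiplier f a x y' \<and> y' $ i > 0) \<longrightarrow> y $ i > 0)"

end

theory Submission
  imports Defs
begin

text \<open>
  For a multiplier \<open>v\<close> close to \<open>ys\<close>, star-convexity of the augmented Lagrangian at \<open>xs\<close> and at \<open>x k\<close>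
  bounds the gap \<open>L (x k) (y k) - L (x k) v\<close> by a multiple of \<open>\<mu> k\<close>. Since the constraint values are
  \<open>- s k\<close> up to \<open>O(\<mu> k)\<close>, this yields \<open>v\<^sub>i s\<^sub>i \<le> K \<mu>\<close>; together with \<open>\<mu> b \<le> y\<^sub>i s\<^sub>i\<close> it gives
  \<open>b v\<^sub>i \<le> K y\<^sub>i\<close>, which survives in the limit. An arbitrary multiplier may be replaced by a point
  near \<open>ys\<close> on the segment to it, because the multipliers form a convex set. The convex case is the
  star-convex one with \<open>\<theta> = 0\<close>, restricted to nonnegative \<open>v\<close>.
\<close>

section \<open>Gradients and one-sided derivatives of star-convex functions\<close>

lemma inner_gradient:
  fixes g :: "'a::euclidean_space \<Rightarrow> real"
  assumes "(g has_derivative D) (at x)"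
  shows "h \<bullet> gradient g x = D h"
proof -
  interpret D: bounded_linear D
    using assms by (rule has_derivative_bounded_linear)
  \<comment> \<open>The Riesz representative of \<open>D\<close> in the standard basis. It supplies
    the witness that the definite description in \<open>gradient\<close> needs.\<close>
  define G where "G = (\<Sum>e\<in>Basis. D e *\<^sub>R e)"
  have D_eq: "D h = h \<bullet> G" for h
  proof -
    have "D h = D (\<Sum>e\<in>Basis. (h \<bullet> e) *\<^sub>R e)"
      by (simp add: euclidean_representation)
    also have "\<dots> = h \<bullet> G"
      by (simp add: D.sum D.scaleR G_def inner_sum_right mult.commute)
    finally show ?thesis .
  qed
  then have "GDERIV g x :> G"
    using assms unfolding gderiv_def by (simp flip: D_eq)
  then show ?thesis
    using gradient_eqI D_eq by metis
qed

lemma has_derivative_along_segment: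
  fixes q :: "'a::real_normed_vector \<Rightarrow> real"
  assumes "(q has_derivative D) (at (t *\<^sub>R x + (1 - t) *\<^sub>R z))"
  shows "((\<lambda>t. q (t *\<^sub>R x + (1 - t) *\<^sub>R z)) has_real_derivative D (x - z)) (at t)"
proof -
  interpret D: bounded_linear D
    using assms by (rule has_derivative_bounded_linear)
  have "((\<lambda>t. t *\<^sub>R x + (1 - t) *\<^sub>R z) has_derivative (\<lambda>r. r *\<^sub>R (x - z))) (at t)"
    by (auto intro!: derivative_eq_intros simp: algebra_simps)
  from has_derivative_compose[OF this assms]
  show ?thesis
    by (simp add: has_field_derivative_def D.scaleR mult.commute[of _ "D (x - z)"] mult_commute_abs)
qed

text \<open>Along the segment that leaves the center \<open>z\<close>, star-convexity bounds every
  difference quotient at parameter 0 by \<open>q x - q z\<close>; let the parameter decrease to 0.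
  This is the gradient inequality of convex analysis, kept only for base point
  \<open>z\<close>.\<close>

lemma star_convex_around_derivative_center:
  assumes "(q has_derivative D) (at z)" "star_convex_around q z S" "x \<in> S"
  shows "D (x - z) \<le> q x - q z"
proof -
  let ?p = "\<lambda>t. q (t *\<^sub>R x + (1 - t) *\<^sub>R z)"
  have "(?p has_real_derivative D (x - z)) (at_right 0)"
    by (rule has_field_derivative_at_within, rule has_derivative_along_segment) (simp add: assms(1))
  then have lim: "((\<lambda>t. (?p t - ?p 0) / (t - 0)) \<longlongrightarrow> D (x - z)) (at_right 0)"
    unfolding has_field_derivative_iff .
  have "(?p t - ?p 0) / (t - 0) \<le> q x - q z" if "0 < t" "t < 1" for t
  proof -
    have "?p t \<le> t * q x + (1 - t) * q z"
      using assms(2,3) that unfolding star_convex_around_def by auto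
    then have "?p t - ?p 0 \<le> (q x - q z) * (t - 0)"
      by (simp add: algebra_simps)
    then show ?thesis
      using that by (subst pos_divide_le_eq) simp_all
  qed
  then have "eventually (\<lambda>t. (?p t - ?p 0) / (t - 0) \<le> q x - q z) (at_right 0)"
    unfolding eventually_at_right_field using zero_less_one by blast
  from tendsto_upperbound[OF lim this] show ?thesis
    by simp
qed

text \<open>The companion gradient inequality, based at the far end of the segment. The quotients
  are now taken at parameter 1 from the left, where division by \<open>t - 1 < 0\<close> turns the
  upper bound on \<open>q\<close> into a lower bound on the quotient.\<close>

lemma star_convex_around_derivative_endpoint:
  assumes "(q has_derivative D) (at x)" "star_convex_around q z S" "x \<in> S"
  shows "q x - q z \<le> D (x - z)"
proof -
  let ?p = "\<lambda>t. q (t *\<^sub>R x + (1 - t) *\<^sub>R z)"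
  have "(?p has_real_derivative D (x - z)) (at_left 1)"
    by (rule has_field_derivative_at_within, rule has_derivative_along_segment) (simp add: assms(1))
  then have lim: "((\<lambda>t. (?p t - ?p 1) / (t - 1)) \<longlongrightarrow> D (x - z)) (at_left 1)"
    unfolding has_field_derivative_iff .
  have "q x - q z \<le> (?p t - ?p 1) / (t - 1)" if "0 < t" "t < 1" for t
  proof -
    have "?p t \<le> t * q x + (1 - t) * q z"
      using assms(2,3) that unfolding star_convex_around_def by auto
    then have "?p t - ?p 1 \<le> (q x - q z) * (t - 1)"
      by (simp add: algebra_simps)
    then show ?thesis
      using that by (subst neg_le_divide_eq) simp_all
  qed
  then have "eventually (\<lambda>t. q x - q z \<le> (?p t - ?p 1) / (t - 1)) (at_left 1)"
    unfolding eventually_at_left_field using zero_less_one by blast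
  from tendsto_lowerbound[OF lim this] show ?thesis
    by simp
qed

lemma convex_on_imp_star_convex_around:
  assumes "convex_on UNIV q"
  shows "star_convex_around q z S"
  unfolding star_convex_around_def
proof (intro ballI)
  fix t :: real and x assume "t \<in> {0..1}"
  then show "q (t *\<^sub>R x + (1 - t) *\<^sub>R z) \<le> t * q x + (1 - t) * q z"
    using convex_onD[OF assms, of t z x] by (simp add: add.commute)
qed

lemma convex_on_sum_of_functions:
  assumes "\<And>i. i \<in> I \<Longrightarrow> convex_on S (g i)" "convex S"
  shows "convex_on S (\<lambda>z. \<Sum>i\<in>I. g i z)"
  using assms(1)
proof (induction I rule: infinite_finite_induct)
  case (insert i I)
  then show ?case
    by (simp add: convex_on_add)
qed (simp_all add: convex_on_const assms(2))

lemma convex_on_lagrangian: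
  assumes "convex_on UNIV f" "\<And>i. convex_on UNIV (\<lambda>z. a z $ i)" "0 \<le> v"
  shows "convex_on UNIV (\<lambda>z. lagrangian f a z v)"
proof -
  have "convex_on UNIV (\<lambda>z. \<Sum>i\<in>UNIV. v $ i * a z $ i)"
    using assms(2,3)
    by (intro convex_on_sum_of_functions convex_on_cmul convex_UNIV) (auto simp: less_eq_vec_def)
  then show ?thesis
    unfolding lagrangian_def inner_vec_def inner_real_def by (intro convex_on_add assms(1))
qed

section \<open>Derivatives of the Lagrangian and the multipliers at a point\<close>

context
  fixes f :: "real ^ 'n \<Rightarrow> real"
    and a :: "real ^ 'n \<Rightarrow> real ^ 'm"
    and f' :: "real ^ 'n \<Rightarrow> (real ^ 'n) \<Rightarrow>\<^sub>L real"
    and a' :: "real ^ 'n \<Rightarrow> (real ^ 'n) \<Rightarrow>\<^sub>L (real ^ 'm)"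
  assumes f_deriv: "\<And>x. (f has_derivative f' x) (at x)"
    and a_deriv: "\<And>x. (a has_derivative a' x) (at x)"
begin

lemma lagrangian_has_derivative:
  "((\<lambda>z. lagrangian f a z v) has_derivative (\<lambda>h. f' x h + v \<bullet> a' x h)) (at x)"
  unfolding lagrangian_def by (auto intro!: derivative_eq_intros f_deriv a_deriv)

lemma inner_gradient_lagrangian:
  "h \<bullet> gradient (\<lambda>z. lagrangian f a z v) x = f' x h + v \<bullet> a' x h"
  by (rule inner_gradient[OF lagrangian_has_derivative])

lemma gradient_lagrangian_eq_0_iff:
  "gradient (\<lambda>z. lagrangian f a z v) x = 0 \<longleftrightarrow> (\<forall>h. f' x h + v \<bullet> a' x h = 0)"
  by (metis inner_gradient_lagrangian inner_zero_right inner_eq_zero_iff)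

lemma aug_lagrangian_has_derivative:
  "((\<lambda>z. aug_lagrangian f a xs \<theta> z v) has_derivative
     (\<lambda>h. f' x h + v \<bullet> a' x h
        + \<theta> * (\<Sum>i\<in>{i. a xs $ i = 0}. 2 * (gradient (\<lambda>z. a z $ i) xs \<bullet> (x - xs))
                 * (gradient (\<lambda>z. a z $ i) xs \<bullet> h)))) (at x)"
  unfolding aug_lagrangian_def
  by (rule derivative_eq_intros lagrangian_has_derivative refl)+
     (auto simp: algebra_simps)

text \<open>Stationarity is an affine condition on the multiplier, and for a fixed feasible point
  the sign and complementarity conditions cut out a convex cone.\<close>

lemma lagrange_multiplier_convex_combination:
  assumes "lagrange_multiplier f a x v" "lagrange_multiplier f a x w" "0 \<le> t" "t \<le> 1"
  shows "lagrange_multiplier f a x ((1 - t) *\<^sub>R v + t *\<^sub>R w)"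
proof -
  have "f' x h + ((1 - t) *\<^sub>R v + t *\<^sub>R w) \<bullet> a' x h
      = (1 - t) * (f' x h + v \<bullet> a' x h) + t * (f' x h + w \<bullet> a' x h)" for h
    by (simp add: inner_add_left algebra_simps)
  then have "f' x h + ((1 - t) *\<^sub>R v + t *\<^sub>R w) \<bullet> a' x h = 0" for h
    using assms(1,2) by (simp add: lagrange_multiplier_def gradient_lagrangian_eq_0_iff)
  then show ?thesis
    using assms
    by (auto simp: lagrange_multiplier_def gradient_lagrangian_eq_0_iff inner_add_right less_eq_vec_def)
qed

text \<open>Stationarity is tested against a fixed direction \<open>h\<close>, where continuity of
  \<open>f'\<close> and \<open>a'\<close> allows passage to the limit. Complementarity follows by
  squeezing \<open>y k \<bullet> s k\<close> between 0 and \<open>\<epsilon> k\<close>.\<close>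

lemma lagrange_multiplier_limit:
  assumes "continuous_on UNIV f'" "continuous_on UNIV a'"
    and x_lim: "x \<longlonglongrightarrow> xs" and y_lim: "y \<longlonglongrightarrow> ys" and s_lim: "s \<longlonglongrightarrow> - a xs"
    and "a xs \<le> 0"
    and y_nonneg: "\<forall>\<^sub>F k in sequentially. 0 \<le> y k"
    and s_nonneg: "\<forall>\<^sub>F k in sequentially. 0 \<le> s k"
    and compl: "\<forall>\<^sub>F k in sequentially. y k \<bullet> s k \<le> \<epsilon> k" and "\<epsilon> \<longlonglongrightarrow> 0"
    and stat: "(\<lambda>k. gradient (\<lambda>z. lagrangian f a z (y k)) (x k)) \<longlonglongrightarrow> 0"
  shows "lagrange_multiplier f a xs ys"
proof -
  have f'_lim: "(\<lambda>k. f' (x k)) \<longlonglongrightarrow> f' xs" and a'_lim: "(\<lambda>k. a' (x k)) \<longlonglongrightarrow> a' xs"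
    using assms(1,2) x_lim by (auto intro: continuous_on_tendsto_compose)
  have "f' xs h + ys \<bullet> a' xs h = 0" for h
  proof -
    have "(\<lambda>k. f' (x k) h + y k \<bullet> a' (x k) h) \<longlonglongrightarrow> f' xs h + ys \<bullet> a' xs h"
      by (intro tendsto_intros f'_lim a'_lim y_lim)
    moreover have "(\<lambda>k. f' (x k) h + y k \<bullet> a' (x k) h) \<longlonglongrightarrow> 0"
      using tendsto_inner[OF tendsto_const stat, of h] by (simp add: inner_gradient_lagrangian)
    ultimately show ?thesis
      by (rule LIMSEQ_unique)
  qed
  moreover have "0 \<le> ys"
    unfolding less_eq_vec_def
  proof
    fix i
    show "0 $ i \<le> ys $ i"
      by (rule tendsto_lowerbound[OF tendsto_vec_nth[OF y_lim]])
         (use y_nonneg in \<open>auto elim: eventually_mono simp: less_eq_vec_def\<close>)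
  qed
  moreover have "a xs \<bullet> ys = 0"
  proof -
    have "(\<lambda>k. y k \<bullet> s k) \<longlonglongrightarrow> 0"
    proof (rule tendsto_sandwich[OF _ compl tendsto_const \<open>\<epsilon> \<longlonglongrightarrow> 0\<close>])
      show "\<forall>\<^sub>F k in sequentially. 0 \<le> y k \<bullet> s k"
        using y_nonneg s_nonneg
        by eventually_elim (auto simp: less_eq_vec_def inner_vec_def intro!: sum_nonneg)
    qed
    moreover have "(\<lambda>k. y k \<bullet> s k) \<longlonglongrightarrow> ys \<bullet> - a xs"
      by (intro tendsto_intros y_lim s_lim)
    ultimately show ?thesis
      using LIMSEQ_unique by (fastforce simp: inner_commute)
  qed
  ultimately show ?thesis
    using \<open>a xs \<le> 0\<close> by (auto simp: lagrange_multiplier_def gradient_lagrangian_eq_0_iff)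
qed

text \<open>Both Lagrangians are compared with \<open>f xs\<close>. Since \<open>xs\<close> is
  stationary for \<open>v\<close> and the penalty \<open>Q\<close> is flat there, the center
  inequality gives \<open>f xs \<le> lagrangian f a z v + Q z\<close>. The endpoint inequality
  bounds \<open>lagrangian f a z w\<close> from above in terms of its value at \<open>xs\<close>,
  which is at most \<open>f xs\<close> because \<open>0 \<le> w\<close> and
  \<open>a xs \<le> 0\<close>.\<close>

lemma star_convex_lagrangian_gap:
  fixes S :: "(real ^ 'n) set" and xs :: "real ^ 'n" and \<theta> :: real
  defines "Q \<equiv> \<lambda>z. \<theta> * (\<Sum>i\<in>{i. a xs $ i = 0}. (gradient (\<lambda>z. a z $ i) xs \<bullet> (z - xs))\<^sup>2)"
  assumes v: "lagrange_multiplier f a xs v" and "0 \<le> w" and "z \<in> S"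
    and star_v: "star_convex_around (\<lambda>z. aug_lagrangian f a xs \<theta> z v) xs S"
    and star_w: "star_convex_around (\<lambda>z. aug_lagrangian f a xs \<theta> z w) xs S"
  shows "lagrangian f a z w - lagrangian f a z v
    \<le> (z - xs) \<bullet> gradient (\<lambda>z. lagrangian f a z w) z + 2 * Q z"
proof -
  have aug: "aug_lagrangian f a xs \<theta> z v = lagrangian f a z v + Q z" for z v
    by (simp add: aug_lagrangian_def Q_def)
  have [simp]: "Q xs = 0"
    by (simp add: Q_def)
  have "0 \<le> aug_lagrangian f a xs \<theta> z v - aug_lagrangian f a xs \<theta> xs v"
    using star_convex_around_derivative_center[OF aug_lagrangian_has_derivative star_v \<open>z \<in> S\<close>] v
    by (simp add: lagrange_multiplier_def gradient_lagrangian_eq_0_iff)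
  moreover have "lagrangian f a xs v = f xs"
    using v by (simp add: lagrange_multiplier_def lagrangian_def inner_commute)
  ultimately have "f xs \<le> lagrangian f a z v + Q z"
    by (simp add: aug)
  \<comment> \<open>\<open>Q\<close> is a quadratic form in \<open>z - xs\<close>, so its derivative
    at \<open>z\<close> in the direction \<open>z - xs\<close> is \<open>2 * Q z\<close>. One copy
    is absorbed by the value of \<open>Q\<close> on the left, leaving one here and two in the final
    bound.\<close>
  moreover have "aug_lagrangian f a xs \<theta> z w - aug_lagrangian f a xs \<theta> xs w
    \<le> (z - xs) \<bullet> gradient (\<lambda>z. lagrangian f a z w) z + 2 * Q z"
    using star_convex_around_derivative_endpoint[OF aug_lagrangian_has_derivative star_w \<open>z \<in> S\<close>]
    by (simp add: inner_gradient_lagrangian Q_def power2_eq_square sum_distrib_left algebra_simps)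
  then have "lagrangian f a z w
    \<le> lagrangian f a xs w + (z - xs) \<bullet> gradient (\<lambda>z. lagrangian f a z w) z + Q z"
    by (simp add: aug)
  moreover have "lagrangian f a xs w \<le> f xs"
    using v \<open>0 \<le> w\<close>
    by (auto simp: lagrangian_def lagrange_multiplier_def less_eq_vec_def inner_vec_def
        intro!: sum_nonpos mult_nonneg_nonpos)
  ultimately show ?thesis
    by linarith
qed

end

section \<open>From the Lagrangian gap to a bound on the slacks\<close>

lemma lagrange_multiplier_inactive:
  assumes "lagrange_multiplier f a x v" "a x $ i \<noteq> 0"
  shows "v $ i = 0"
proof -
  have "(\<Sum>j\<in>UNIV. - (a x $ j * v $ j)) = 0"
    using assms(1) by (simp add: lagrange_multiplier_def inner_vec_def sum_negf)
  then have "a x $ i * v $ i = 0"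
    using assms(1)
    by (subst (asm) sum_nonneg_eq_0_iff)
       (auto simp: lagrange_multiplier_def less_eq_vec_def mult_le_0_iff)
  with assms(2) show ?thesis
    by simp
qed

text \<open>The objective cancels in the gap, leaving
  \<open>y k \<bullet> a (x k) - v \<bullet> a (x k)\<close>. Replacing \<open>a (x k)\<close> by
  \<open>- s k\<close> costs a multiple of \<open>\<mu> k\<close> in each product, and
  \<open>y k \<bullet> s k\<close> is itself at most \<open>\<mu> k * c\<close>. Hence
  \<open>v \<bullet> s k\<close> is bounded by a multiple of \<open>\<mu> k\<close>, and so is each
  of its nonnegative terms.\<close>

lemma slack_bound_of_gap:
  fixes a :: "real ^ 'n \<Rightarrow> real ^ 'm"
  assumes v: "lagrange_multiplier f a xs v"
    and mu_pos: "\<forall>\<^sub>F k in sequentially. \<mu> k > 0"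
    and a_lim: "(\<lambda>k. a (x k)) \<longlonglongrightarrow> a xs"
    and s_lim: "s \<longlonglongrightarrow> - a xs"
    and y_nonneg: "\<forall>\<^sub>F k in sequentially. 0 \<le> y k"
    and s_nonneg: "\<forall>\<^sub>F k in sequentially. 0 \<le> s k"
    and y_lim: "y \<longlonglongrightarrow> ys"
    and compl_upper: "\<forall>\<^sub>F k in sequentially. y k \<bullet> s k \<le> \<mu> k * c"
    and "0 \<le> u"
    and primal: "\<forall>\<^sub>F k in sequentially. \<forall>i. a xs $ i = 0 \<longrightarrow> \<bar>a (x k) $ i + s k $ i\<bar> \<le> \<mu> k * u"
    and gap: "\<forall>\<^sub>F k in sequentially. lagrangian f a (x k) (y k) - lagrangian f a (x k) v \<le> \<mu> k * G"
  obtains K where "\<forall>\<^sub>F k in sequentially. v $ i * s k $ i \<le> \<mu> k * K"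
proof -
  \<comment> \<open>For an active index the residual is at most \<open>\<mu> k * u\<close> in
    absolute value and \<open>y k $ i\<close> stays bounded. For an inactive one nothing is assumed
    on the residual, and complementarity has to take over.\<close>
  have "\<exists>M. \<forall>\<^sub>F k in sequentially. - (\<mu> k * M) \<le> y k $ i * (a (x k) $ i + s k $ i)" for i
  proof (cases "a xs $ i = 0")
    case True
    have "\<forall>\<^sub>F k in sequentially. y k $ i < ys $ i + 1"
      by (rule order_tendstoD[OF tendsto_vec_nth[OF y_lim]]) simp
    then have "\<forall>\<^sub>F k in sequentially. - (\<mu> k * ((ys $ i + 1) * u)) \<le> y k $ i * (a (x k) $ i + s k $ i)"
      using y_nonneg primal mu_pos
    proof eventually_elim
      case (elim k)
      have y: "0 \<le> y k $ i"
        using elim(2) by (simp add: less_eq_vec_def)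
      have "y k $ i * (- (\<mu> k * u)) \<le> y k $ i * (a (x k) $ i + s k $ i)"
        using elim(3) True by (intro mult_left_mono y) force
      moreover have "y k $ i * (\<mu> k * u) \<le> (ys $ i + 1) * (\<mu> k * u)"
        using elim(1,4) \<open>0 \<le> u\<close> by (intro mult_right_mono) auto
      ultimately show ?case
        by (simp add: algebra_simps)
    qed
    then show ?thesis ..
  next
    case False
    \<comment> \<open>The limit is \<open>- a xs $ i > 0\<close>, so eventually the residual
      \<open>a (x k) $ i + s k $ i\<close> is at least \<open>- s k $ i\<close>. Its product with
      \<open>y k $ i\<close> is then bounded below through
      \<open>y k \<bullet> s k \<le> \<mu> k * c\<close>.\<close>
    have "(\<lambda>k. a (x k) $ i + 2 * s k $ i) \<longlonglongrightarrow> a xs $ i + 2 * (- a xs) $ i"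
      by (intro tendsto_intros a_lim s_lim)
    moreover have "a xs $ i < 0"
      using v False by (auto simp: lagrange_multiplier_def less_eq_vec_def order_less_le)
    ultimately have "\<forall>\<^sub>F k in sequentially. 0 < a (x k) $ i + 2 * s k $ i"
      by (intro order_tendstoD) auto
    then have "\<forall>\<^sub>F k in sequentially. - (\<mu> k * c) \<le> y k $ i * (a (x k) $ i + s k $ i)"
      using y_nonneg s_nonneg compl_upper
    proof eventually_elim
      case (elim k)
      have "y k $ i * s k $ i \<le> y k \<bullet> s k"
        using elim(2,3) unfolding inner_vec_def inner_real_def
        by (intro member_le_sum) (auto simp: less_eq_vec_def)
      moreover have "y k $ i * (- s k $ i) \<le> y k $ i * (a (x k) $ i + s k $ i)"
        using elim(1,2) by (intro mult_left_mono) (auto simp: less_eq_vec_def)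
      ultimately show ?case
        using elim(4) by simp
    qed
    then show ?thesis ..
  qed
  then obtain M where "\<And>i. \<forall>\<^sub>F k in sequentially. - (\<mu> k * M i) \<le> y k $ i * (a (x k) $ i + s k $ i)"
    by atomize_elim (rule choice, rule allI)
  then have "\<forall>\<^sub>F k in sequentially. \<forall>i. - (\<mu> k * M i) \<le> y k $ i * (a (x k) $ i + s k $ i)"
    by (rule eventually_all_finite)
  then have "\<forall>\<^sub>F k in sequentially. v $ i * s k $ i
      \<le> \<mu> k * (G + c + (\<Sum>i\<in>UNIV. M i) + (\<Sum>i\<in>UNIV. v $ i * u))"
    using gap compl_upper primal s_nonneg
  proof eventually_elim
    case (elim k)
    have v0: "0 \<le> v $ j" for j
      using v by (simp add: lagrange_multiplier_def less_eq_vec_def)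
    have "(\<Sum>i\<in>UNIV. - (\<mu> k * M i)) \<le> (\<Sum>i\<in>UNIV. y k $ i * (a (x k) $ i + s k $ i))"
      using elim(1) by (intro sum_mono) simp
    then have 1: "- (\<mu> k * (\<Sum>i\<in>UNIV. M i)) \<le> y k \<bullet> a (x k) + y k \<bullet> s k"
      by (simp add: inner_vec_def sum_distrib_left sum_negf sum.distrib ring_distribs)
    \<comment> \<open>Only active residuals are controlled by \<open>primal\<close>; at an inactive
      index \<open>v $ j\<close> vanishes and both sides are 0.\<close>
    have "v $ j * (a (x k) $ j + s k $ j) \<le> \<mu> k * (v $ j * u)" for j
    proof (cases "a xs $ j = 0")
      case True
      then have "v $ j * (a (x k) $ j + s k $ j) \<le> v $ j * (\<mu> k * u)"
        using elim(4) by (intro mult_left_mono v0) force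
      then show ?thesis
        by (simp add: mult_ac)
    qed (simp add: lagrange_multiplier_inactive[OF v])
    then have "(\<Sum>i\<in>UNIV. v $ i * (a (x k) $ i + s k $ i)) \<le> (\<Sum>i\<in>UNIV. \<mu> k * (v $ i * u))"
      by (intro sum_mono)
    then have 2: "v \<bullet> a (x k) + v \<bullet> s k \<le> \<mu> k * (\<Sum>i\<in>UNIV. v $ i * u)"
      by (simp add: inner_vec_def sum_distrib_left sum.distrib ring_distribs)
    have "v $ i * s k $ i \<le> v \<bullet> s k"
      using elim(5) v0 unfolding inner_vec_def inner_real_def
      by (intro member_le_sum) (auto simp: less_eq_vec_def)
    with 1 2 elim(2,3) show ?case
      by (simp add: lagrangian_def ring_distribs)
  qed
  then show ?thesis
    by (rule that)
qed

section \<open>The limit multiplier and its maximal complementarity\<close>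

theorem theorem3:
  fixes f :: "real ^ 'n \<Rightarrow> real"
    and a :: "real ^ 'n \<Rightarrow> real ^ 'm"
    and x :: "nat \<Rightarrow> real ^ 'n"
    and y s :: "nat \<Rightarrow> real ^ 'm"
    and \<mu> :: "nat \<Rightarrow> real"
    and xs :: "real ^ 'n"
    and ys :: "real ^ 'm"
    and b c u d :: real
  assumes f_C1: "continuously_differentiable f"
    and a_C1: "continuously_differentiable a"
    and mu_pos: "\<forall>\<^sub>F k in sequentially. \<mu> k > 0"
    and mu_lim: "\<mu> \<longlonglongrightarrow> 0"
    and x_lim: "x \<longlonglongrightarrow> xs"
    and feasible: "a xs \<le> 0"
    and s_lim: "s \<longlonglongrightarrow> - a xs"
    and y_nonneg: "\<forall>\<^sub>F k in sequentially. 0 \<le> y k"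
    and s_nonneg: "\<forall>\<^sub>F k in sequentially. 0 \<le> s k"
    and y_lim: "y \<longlonglongrightarrow> ys"
    and b_pos: "0 < b"
    and b_le_c: "b \<le> c"
    and compl_lower: "\<forall>\<^sub>F k in sequentially. \<forall>i. a xs $ i = 0 \<longrightarrow> \<mu> k * b \<le> y k $ i * s k $ i"
    and compl_upper: "\<forall>\<^sub>F k in sequentially. y k \<bullet> s k \<le> \<mu> k * c"
    and u_nonneg: "0 \<le> u"
    and primal: "\<forall>\<^sub>F k in sequentially. \<forall>i. a xs $ i = 0 \<longrightarrow> \<bar>a (x k) $ i + s k $ i\<bar> \<le> \<mu> k * u"
    and d_nonneg: "0 \<le> d"
    and dual: "\<forall>\<^sub>F k in sequentially.
        norm (gradient (\<lambda>z. lagrangian f a z (y k)) (x k)) \<le> d * \<mu> k * (norm1 (y k) + 1)"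
    and convexity:
      "(convex_on UNIV f \<and> (\<forall>i. convex_on UNIV (\<lambda>z. a z $ i)))
       \<or> ((\<exists>\<theta>\<ge>0. \<exists>S W. xs \<in> interior S \<and> ys \<in> interior W \<and>
              (\<forall>v\<in>W. star_convex_around (\<lambda>z. aug_lagrangian f a xs \<theta> z v) xs S))
          \<and> (\<exists>C\<ge>0. \<forall>\<^sub>F k in sequentially. norm (x k - xs) \<le> C * sqrt (\<mu> k)))"
  shows "lagrange_multiplier f a xs ys \<and> maximally_complementary f a xs ys"
proof -
  obtain f' where f': "\<And>x. (f has_derivative blinfun_apply (f' x)) (at x)" "continuous_on UNIV f'"
    using f_C1 unfolding continuously_differentiable_def by blast
  obtain a' where a': "\<And>x. (a has_derivative blinfun_apply (a' x)) (at x)" "continuous_on UNIV a'"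
    using a_C1 unfolding continuously_differentiable_def by blast
  note derivs = f'(1) a'(1)
  let ?g = "\<lambda>k. gradient (\<lambda>z. lagrangian f a z (y k)) (x k)"
  \<comment> \<open>Eventually \<open>norm1 (y k) + 1\<close> is below \<open>norm1 ys + 2\<close>,
    so \<open>D\<close> makes the stationarity error at most \<open>\<mu> k * D\<close>.\<close>
  define D where "D = d * (norm1 ys + 2)"

  have "(\<lambda>k. norm1 (y k)) \<longlonglongrightarrow> norm1 ys"
    unfolding norm1_def by (intro tendsto_intros y_lim)
  then have "\<forall>\<^sub>F k in sequentially. norm1 (y k) < norm1 ys + 1"
    by (rule order_tendstoD) simp
  then have grad_bound: "\<forall>\<^sub>F k in sequentially. norm (?g k) \<le> \<mu> k * D"
    using dual mu_pos
  proof eventually_elim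
    case (elim k)
    have "(d * \<mu> k) * (norm1 (y k) + 1) \<le> (d * \<mu> k) * (norm1 ys + 2)"
      using elim(1,3) d_nonneg by (intro mult_left_mono) auto
    with elim(2) show ?case
      by (simp add: D_def mult_ac)
  qed
  have mu_mult_lim: "(\<lambda>k. \<mu> k * r) \<longlonglongrightarrow> 0" for r
    using tendsto_mult_right[OF mu_lim, of r] by simp
  have "?g \<longlonglongrightarrow> 0"
    using grad_bound mu_mult_lim by (rule Lim_null_comparison)
  then have ys: "lagrange_multiplier f a xs ys"
    using lagrange_multiplier_limit[OF derivs f'(2) a'(2) x_lim y_lim s_lim feasible
        y_nonneg s_nonneg compl_upper mu_mult_lim] by blast

  define Q where "Q = (\<lambda>z. \<Sum>i\<in>{i. a xs $ i = 0}. (gradient (\<lambda>z. a z $ i) xs \<bullet> (z - xs))\<^sup>2)"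
  \<comment> \<open>Both alternatives of \<open>convexity\<close> are put into one form. In the
    convex case \<open>\<theta> = 0\<close> and \<open>R = 0\<close> with both neighborhoods the
    whole space; the guard \<open>0 \<le> v\<close> is there because a negative weight would destroy
    convexity of the Lagrangian.\<close>
  obtain \<theta> S W R where S: "xs \<in> interior S" and W: "ys \<in> interior W"
    and star: "\<And>v. v \<in> W \<Longrightarrow> 0 \<le> v \<Longrightarrow> star_convex_around (\<lambda>z. aug_lagrangian f a xs \<theta> z v) xs S"
    and Q_bound: "\<forall>\<^sub>F k in sequentially. \<theta> * Q (x k) \<le> \<mu> k * R"
    using convexity
  proof (elim disjE conjE exE)
    assume conv: "convex_on UNIV f" "\<forall>i. convex_on UNIV (\<lambda>z. a z $ i)"
    show thesis
    proof (rule that[of UNIV UNIV 0 0])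
      fix v :: "real ^ 'm" assume "0 \<le> v"
      then show "star_convex_around (\<lambda>z. aug_lagrangian f a xs 0 z v) xs UNIV"
        unfolding aug_lagrangian_def mult_zero_left add_0_right
        by (intro convex_on_imp_star_convex_around convex_on_lagrangian conv(1) conv(2)[rule_format])
    qed simp_all
  next
    fix \<theta> S W C
    assume \<theta>: "0 \<le> \<theta>" and SW: "xs \<in> interior S" "ys \<in> interior W"
      and star: "\<forall>v\<in>W. star_convex_around (\<lambda>z. aug_lagrangian f a xs \<theta> z v) xs S"
      and rate: "\<forall>\<^sub>F k in sequentially. norm (x k - xs) \<le> C * sqrt (\<mu> k)"
    let ?N = "\<lambda>i. (norm (gradient (\<lambda>z. a z $ i) xs))\<^sup>2"
    \<comment> \<open>By Cauchy-Schwarz \<open>Q\<close> is of second order in the distance to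
      \<open>xs\<close>, so the rate \<open>C * sqrt (\<mu> k)\<close> becomes a bound linear in
      \<open>\<mu> k\<close>.\<close>
    have "\<forall>\<^sub>F k in sequentially. \<theta> * Q (x k) \<le> \<mu> k * (\<theta> * (\<Sum>i\<in>{i. a xs $ i = 0}. ?N i * C\<^sup>2))"
      using rate mu_pos
    proof eventually_elim
      case (elim k)
      have "(norm (x k - xs))\<^sup>2 \<le> (C * sqrt (\<mu> k))\<^sup>2"
        using elim by (intro power_mono) auto
      then have n: "(norm (x k - xs))\<^sup>2 \<le> C\<^sup>2 * \<mu> k"
        using elim by (simp add: power_mult_distrib)
      have "(gradient (\<lambda>z. a z $ i) xs \<bullet> (x k - xs))\<^sup>2 \<le> \<mu> k * (?N i * C\<^sup>2)" for i
      proof -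
        have "(gradient (\<lambda>z. a z $ i) xs \<bullet> (x k - xs))\<^sup>2 \<le> ?N i * (norm (x k - xs))\<^sup>2"
          using Cauchy_Schwarz_ineq by (simp add: power2_norm_eq_inner)
        also have "\<dots> \<le> ?N i * (C\<^sup>2 * \<mu> k)"
          by (intro mult_left_mono n) simp
        finally show ?thesis
          by (simp add: mult_ac)
      qed
      then have "Q (x k) \<le> \<mu> k * (\<Sum>i\<in>{i. a xs $ i = 0}. ?N i * C\<^sup>2)"
        unfolding Q_def sum_distrib_left by (intro sum_mono)
      then have "\<theta> * Q (x k) \<le> \<theta> * (\<mu> k * (\<Sum>i\<in>{i. a xs $ i = 0}. ?N i * C\<^sup>2))"
        by (rule mult_left_mono) (rule \<theta>)
      then show ?case
        by (simp only: mult.left_commute)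
    qed
    with SW star show thesis
      by (intro that) auto
  qed

  have x_near: "\<forall>\<^sub>F k in sequentially. x k \<in> S"
    using topological_tendstoD[OF x_lim open_interior S]
    by (rule eventually_mono) (rule interior_subset[THEN subsetD])
  have y_near: "\<forall>\<^sub>F k in sequentially. y k \<in> W"
    using topological_tendstoD[OF y_lim open_interior W]
    by (rule eventually_mono) (rule interior_subset[THEN subsetD])
  have "(\<lambda>k. norm (x k - xs)) \<longlonglongrightarrow> 0"
    using x_lim by (simp add: LIM_zero tendsto_norm_zero)
  then have x_bounded: "\<forall>\<^sub>F k in sequentially. norm (x k - xs) < 1"
    by (rule order_tendstoD) simp
  have a_lim: "(\<lambda>k. a (x k)) \<longlonglongrightarrow> a xs"
    by (rule isCont_tendsto_compose[OF has_derivative_continuous[OF a'(1)] x_lim])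

  have pos: "0 < ys $ i" if v: "lagrange_multiplier f a xs v" "v \<in> W" "0 < v $ i" for v i
  proof -
    have v0: "0 \<le> v"
      using v(1) by (simp add: lagrange_multiplier_def)
    \<comment> \<open>The gap lemma is applied with \<open>w = y k\<close>. The gradient term costs
      \<open>\<mu> k * D\<close> because \<open>x k\<close> is within distance 1 of
      \<open>xs\<close>; the two penalty terms cost \<open>\<mu> k * R\<close> each.\<close>
    have "\<forall>\<^sub>F k in sequentially.
        lagrangian f a (x k) (y k) - lagrangian f a (x k) v \<le> \<mu> k * (D + 2 * R)"
      using x_near y_near x_bounded y_nonneg grad_bound Q_bound
    proof eventually_elim
      case (elim k)
      have "(x k - xs) \<bullet> ?g k \<le> norm (x k - xs) * norm (?g k)"
        by (rule norm_cauchy_schwarz)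
      also have "\<dots> \<le> 1 * (\<mu> k * D)"
        using elim(3,5) by (intro mult_mono) auto
      finally show ?case
        using star_convex_lagrangian_gap[OF derivs v(1) elim(4,1) star[OF v(2) v0] star[OF elim(2,4)]]
          elim(6)
        unfolding Q_def by (simp add: ring_distribs)
    qed
    from slack_bound_of_gap[OF v(1) mu_pos a_lim s_lim y_nonneg s_nonneg y_lim compl_upper u_nonneg
        primal this]
    obtain K where K: "\<forall>\<^sub>F k in sequentially. v $ i * s k $ i \<le> \<mu> k * K" .
    have active: "a xs $ i = 0"
      using lagrange_multiplier_inactive[OF v(1)] v(3) by force
    \<comment> \<open>The product \<open>y k $ i * s k $ i * v $ i\<close> is bounded below by
      \<open>compl_lower\<close> and above by \<open>K\<close>. The slack drops out and the common
      factor \<open>\<mu> k\<close> cancels.\<close>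
    have "\<forall>\<^sub>F k in sequentially. b * v $ i \<le> y k $ i * K"
      using K mu_pos compl_lower y_nonneg
    proof eventually_elim
      case (elim k)
      have "\<mu> k * (b * v $ i) \<le> y k $ i * s k $ i * v $ i"
        using elim(3) active v(3) mult_right_mono[of "\<mu> k * b" "y k $ i * s k $ i" "v $ i"]
        by (simp add: mult_ac)
      also have "\<dots> \<le> y k $ i * (\<mu> k * K)"
        using elim(1,4) mult_left_mono[of "v $ i * s k $ i" "\<mu> k * K" "y k $ i"]
        by (simp add: mult_ac less_eq_vec_def)
      finally have "\<mu> k * (b * v $ i) \<le> \<mu> k * (y k $ i * K)"
        by (simp add: mult_ac)
      with elim(2) show ?case
        by simp
    qed
    moreover have "(\<lambda>k. y k $ i * K) \<longlonglongrightarrow> ys $ i * K"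
      by (intro tendsto_intros y_lim)
    ultimately have "b * v $ i \<le> ys $ i * K"
      by (intro tendsto_lowerbound) auto
    moreover have "0 < b * v $ i"
      using b_pos v(3) by simp
    \<comment> \<open>The sign of \<open>K\<close> is not known, so \<open>0 < ys $ i * K\<close> is
      used only to exclude zero; the sign of \<open>ys $ i\<close> comes from its being a
      multiplier.\<close>
    ultimately have "ys $ i \<noteq> 0"
      by auto
    moreover have "0 \<le> ys $ i"
      using ys by (simp add: lagrange_multiplier_def less_eq_vec_def)
    ultimately show ?thesis
      by simp
  qed

  have "0 < ys $ i" if w: "lagrange_multiplier f a xs w" "0 < w $ i" for w i
  proof -
    let ?v = "\<lambda>t. (1 - t) *\<^sub>R ys + t *\<^sub>R w"
    \<comment> \<open>The limit is taken from the right: small \<open>t\<close> keeps the point in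
      \<open>W\<close>, while \<open>t > 0\<close> keeps its component \<open>i\<close>
      positive.\<close>
    have "(?v \<longlongrightarrow> (1 - 0) *\<^sub>R ys + 0 *\<^sub>R w) (at_right 0)"
      by (intro tendsto_intros)
    then have "\<forall>\<^sub>F t in at_right 0. ?v t \<in> interior W"
      using W by (intro topological_tendstoD) auto
    moreover have "\<forall>\<^sub>F t in at_right (0::real). t \<in> {0<..<1}"
      by (rule eventually_at_right_real) simp
    ultimately have "\<forall>\<^sub>F t in at_right 0. ?v t \<in> interior W \<and> t \<in> {0<..<1}"
      by eventually_elim simp
    then obtain t where t: "?v t \<in> interior W" "0 < t" "t < 1"
      using eventually_happens'[OF trivial_limit_at_right_real] by fastforce
    show ?thesis
    proof (rule pos)
      show "lagrange_multiplier f a xs (?v t)"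
        using t by (intro lagrange_multiplier_convex_combination[OF derivs ys w(1)]) auto
      show "?v t \<in> W"
        using t(1) interior_subset by blast
      have "0 \<le> ys $ i"
        using ys by (simp add: lagrange_multiplier_def less_eq_vec_def)
      then show "0 < ?v t $ i"
        using t w(2) by (simp add: add_nonneg_pos)
    qed
  qed
  with ys show ?thesis
    by (auto simp: maximally_complementary_def)
qed

end
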